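(* Let $n\ge 1$ and let $K,K'\subseteq\mathbb{R}^n$ be compact convex bodies (compact convex sets with nonempty interior). Then $K\equiv_{\mathcal{L}_{\mathrm{aff}}}K'$ (that is, $K$ and $K'$ satisfy the same first-order $\mathcal{L}_{\mathrm{aff}}$-sentences) if and only if $K$ and $K'$ are affinely equivalent, i.e. there is an affine bijection $F\colon\mathbb{R}^n\to\mathbb{R}^n$ with $F(K)=K'$. (No smoothness, strict-convexity or polytopality hypothesis is imposed.)
   Context: $\mathcal{L}_{\mathrm{aff}}$ is the first-order language (with equality) having one ternary relation symbol $B$ and one binary function symbol $C_\lambda$ for each real $\lambda\in[0,1]$. A convex set $K\subseteq\mathbb{R}^n$ is regarded as an $\mathcal{L}_{\mathrm{aff}}$-structure with universe $K$, where $C_\lambda(p,q)=(1-\lambda)p+\lambda q$ and $B(a,x,b)$ holds iff $x\in[a,b]$ (the closed segment). $\equiv_{\mathcal{L}}$ denotes elementary equivalence in the language $\mathcal{L}$. A convex body is a compact convex subset of $\mathbb{R}^n$ with nonempty interior. *)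

theory Defs
  imports "HOL-Analysis.Analysis"
begin

text \<open>The index set of the function symbols, the real interval from 0 to 1.\<close>

typedef unit_interval = "{0..1::real}"
  morphisms weight_of Weight
  by auto

text \<open>
  Syntax of first-order logic with equality over the language with one ternary relation
  symbol (\<open>Btw\<close>) and a binary function symbol \<open>Comb l\<close> for each weight \<open>l\<close>.  Variables are
  named by natural numbers; the remaining connectives and the universal quantifier are the
  usual abbreviations.
\<close>

datatype aff_term =
    Var nat
  | Comb unit_interval aff_term aff_term

datatype aff_formula =
    Eq aff_term aff_term
  | Btw aff_term aff_term aff_term
  | Neg aff_formula
  | Conj aff_formula aff_formula
  | Exi nat aff_formula

primrec term_vars :: "aff_term \<Rightarrow> nat set" where
  "term_vars (Var i) = {i}"
| "term_vars (Comb l s t) = term_vars s \<union> term_vars t"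

primrec free_vars :: "aff_formula \<Rightarrow> nat set" where
  "free_vars (Eq s t) = term_vars s \<union> term_vars t"
| "free_vars (Btw s t u) = term_vars s \<union> term_vars t \<union> term_vars u"
| "free_vars (Neg \<phi>) = free_vars \<phi>"
| "free_vars (Conj \<phi> \<psi>) = free_vars \<phi> \<union> free_vars \<psi>"
| "free_vars (Exi i \<phi>) = free_vars \<phi> - {i}"

definition sentence :: "aff_formula \<Rightarrow> bool" where
  "sentence \<phi> \<longleftrightarrow> free_vars \<phi> = {}"

primrec term_val :: "(nat \<Rightarrow> 'a::real_vector) \<Rightarrow> aff_term \<Rightarrow> 'a" where
  "term_val e (Var i) = e i"
| "term_val e (Comb l s t) =
     (1 - weight_of l) *\<^sub>R term_val e s + weight_of l *\<^sub>R term_val e t"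

text \<open>
  Satisfaction in the structure with universe \<open>K\<close>.  It is meaningful for convex \<open>K\<close> and
  assignments into \<open>K\<close>, in which case all terms take values in \<open>K\<close>.
\<close>

primrec sat :: "'a::real_vector set \<Rightarrow> (nat \<Rightarrow> 'a) \<Rightarrow> aff_formula \<Rightarrow> bool" where
  "sat K e (Eq s t) \<longleftrightarrow> term_val e s = term_val e t"
| "sat K e (Btw s t u) \<longleftrightarrow> term_val e t \<in> closed_segment (term_val e s) (term_val e u)"
| "sat K e (Neg \<phi>) \<longleftrightarrow> \<not> sat K e \<phi>"
| "sat K e (Conj \<phi> \<psi>) \<longleftrightarrow> sat K e \<phi> \<and> sat K e \<psi>"
| "sat K e (Exi i \<phi>) \<longleftrightarrow> (\<exists>x\<in>K. sat K (e(i := x)) \<phi>)"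

definition models :: "'a::real_vector set \<Rightarrow> aff_formula \<Rightarrow> bool" where
  "models K \<phi> \<longleftrightarrow> (\<forall>e. range e \<subseteq> K \<longrightarrow> sat K e \<phi>)"

definition elementarily_equivalent :: "'a::real_vector set \<Rightarrow> 'b::real_vector set \<Rightarrow> bool" where
  "elementarily_equivalent K K' \<longleftrightarrow> (\<forall>\<phi>. sentence \<phi> \<longrightarrow> (models K \<phi> \<longleftrightarrow> models K' \<phi>))"

definition convex_body :: "'a::euclidean_space set \<Rightarrow> bool" where
  "convex_body K \<longleftrightarrow> compact K \<and> convex K \<and> interior K \<noteq> {}"

definition affine_map :: "('a::real_vector \<Rightarrow> 'b::real_vector) \<Rightarrow> bool" where
  "affine_map F \<longleftrightarrow> (\<exists>L c. linear L \<and> (\<forall>x. F x = L x + c))"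

definition affinely_equivalent :: "'a::real_vector set \<Rightarrow> 'a set \<Rightarrow> bool" where
  "affinely_equivalent K K' \<longleftrightarrow> (\<exists>F. affine_map F \<and> bij F \<and> F ` K = K')"

end

theory Submission
  imports Defs
begin

text \<open>
  Fix an affine frame \<open>p\<^sub>0, \<dots>, p\<^sub>n\<close> in \<open>K\<close> with \<open>p\<^sub>0\<close> interior.  For every point \<open>x = \<Sum>\<^sub>i t\<^sub>i p\<^sub>i\<close> of the
  ambient space, ``\<open>\<Sum>\<^sub>i t\<^sub>i p\<^sub>i\<close> lies in the body'' is a first-order condition on the frame, because
  negative weights can be moved to the other side of an equation between convex combinations.
  By elementary equivalence, any finitely many such conditions, positive or negative, are met
  by a tuple in \<open>K'\<close>.  Weakening the negative ones to ``does not lie in the interior'' makes all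
  of them closed, so compactness of the space of assignments into \<open>K'\<close> yields an affine map \<open>F\<close>
  with \<open>F(K) \<subseteq> K'\<close> and \<open>F\<^sup>-\<^sup>1(int K') \<subseteq> K\<close>.  The map \<open>F\<close> may still be degenerate; this is
  excluded by the additional condition that for a fixed \<open>\<lambda> < 1\<close> and every \<open>y\<close> there is a \<open>z\<close> with
  \<open>p\<^sub>0 = (1 - \<lambda>) y + \<lambda> z\<close>, which is first-order and closed and forces \<open>F(p\<^sub>0)\<close> into the interior
  of \<open>K'\<close>: then a line contracted by \<open>F\<close> would give a line in the bounded set \<open>K\<close>.
\<close>

section \<open>Affine isomorphisms preserve satisfaction\<close>

lemma affine_map_combination:
  assumes "affine_map F"
  shows "F ((1 - u) *\<^sub>R x + u *\<^sub>R y) = (1 - u) *\<^sub>R F x + u *\<^sub>R F y"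
proof -
  obtain L c where "linear L" and F: "\<And>x. F x = L x + c"
    using assms unfolding affine_map_def by blast
  have "(1 - u) *\<^sub>R c + u *\<^sub>R c = c"
    by (simp flip: scaleR_left_distrib)
  then show ?thesis
    by (simp add: F linear_add[OF \<open>linear L\<close>] linear_scale[OF \<open>linear L\<close>] scaleR_right_distrib)
qed

lemma affine_map_closed_segment:
  assumes "affine_map F"
  shows "F ` closed_segment a b = closed_segment (F a) (F b)"
  unfolding closed_segment_image_interval
  by (simp add: image_image affine_map_combination[OF assms])

lemma term_val_affine_image:
  assumes "affine_map F"
  shows "term_val (F \<circ> e) s = F (term_val e s)"
  by (induction s) (simp_all add: affine_map_combination[OF assms])

text \<open>Segments are carried onto segments, and injectivity reflects equality and betweenness
  back. In the quantifier case every witness in the image has the form \<open>F x\<close> with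
  \<open>x\<close> in \<open>K\<close>.\<close>

lemma sat_affine_image:
  assumes F: "affine_map F" "inj F"
  shows "sat (F ` K) (F \<circ> e) \<phi> \<longleftrightarrow> sat K e \<phi>"
proof (induction \<phi> arbitrary: e)
  case (Btw s t u)
  show ?case
    unfolding sat.simps term_val_affine_image[OF F(1)]
    unfolding affine_map_closed_segment[OF F(1), symmetric] inj_image_mem_iff[OF F(2)] ..
next
  case (Exi i \<phi>)
  have "sat (F ` K) ((F \<circ> e)(i := F x)) \<phi> \<longleftrightarrow> sat K (e(i := x)) \<phi>" for x
  proof -
    have *: "(F \<circ> e)(i := F x) = F \<circ> e(i := x)"
      by auto
    show ?thesis
      unfolding * by (rule Exi)
  qed
  then show ?case
    unfolding sat.simps by blast
qed (simp_all add: term_val_affine_image[OF F(1)] inj_eq[OF F(2)])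

lemma models_affine_image:
  assumes F: "affine_map F" "inj F"
  shows "models (F ` K) \<phi> \<longleftrightarrow> models K \<phi>"
proof -
  have "models (F ` K) \<phi> \<longleftrightarrow> (\<forall>e. range e \<subseteq> K \<longrightarrow> sat (F ` K) (F \<circ> e) \<phi>)"
  proof -
    have "\<exists>e. range e \<subseteq> K \<and> e' = F \<circ> e" if "range e' \<subseteq> F ` K" for e' :: "nat \<Rightarrow> _"
    proof -
      have "\<forall>i. \<exists>x\<in>K. e' i = F x"
        using that by auto
      then obtain e where "\<forall>i. e i \<in> K \<and> e' i = F (e i)"
        by metis
      then show ?thesis
        by (intro exI[of _ e]) auto
    qed
    moreover have "range (F \<circ> e) \<subseteq> F ` K" if "range e \<subseteq> K" for e :: "nat \<Rightarrow> _"
      using that by auto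
    ultimately show ?thesis
      unfolding models_def by metis
  qed
  then show ?thesis
    by (simp add: sat_affine_image[OF F] models_def)
qed

lemma affinely_equivalent_imp_elementarily_equivalent:
  "affinely_equivalent K K' \<Longrightarrow> elementarily_equivalent K K'"
  unfolding affinely_equivalent_def elementarily_equivalent_def
  using models_affine_image bij_is_inj by blast

section \<open>Closing and conjoining formulas\<close>

lemma finite_term_vars: "finite (term_vars s)"
  by (induction s) auto

lemma finite_free_vars: "finite (free_vars \<phi>)"
  by (induction \<phi>) (auto simp: finite_term_vars)

lemma term_val_cong: "(\<And>i. i \<in> term_vars s \<Longrightarrow> e i = e' i) \<Longrightarrow> term_val e s = term_val e' s"
  by (induction s) auto

lemma sat_cong: "(\<And>i. i \<in> free_vars \<phi> \<Longrightarrow> e i = e' i) \<Longrightarrow> sat K e \<phi> \<longleftrightarrow> sat K e' \<phi>"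
proof (induction \<phi> arbitrary: e e')
  case (Eq s t)
  then show ?case
    using term_val_cong[of s e e'] term_val_cong[of t e e'] by auto
next
  case (Btw s t u)
  then show ?case
    using term_val_cong[of s e e'] term_val_cong[of t e e'] term_val_cong[of u e e'] by auto
next
  case (Neg \<phi>)
  have "sat K e \<phi> \<longleftrightarrow> sat K e' \<phi>"
    by (intro Neg.IH Neg.prems; simp)
  then show ?case by simp
next
  case (Conj \<phi> \<psi>)
  have "sat K e \<phi> \<longleftrightarrow> sat K e' \<phi>" "sat K e \<psi> \<longleftrightarrow> sat K e' \<psi>"
    by (intro Conj.IH Conj.prems; simp)+
  then show ?case by simp
next
  case (Exi i \<phi>)
  have "sat K (e(i := x)) \<phi> \<longleftrightarrow> sat K (e'(i := x)) \<phi>" for x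
    using Exi.prems by (intro Exi.IH) auto
  then show ?case by simp
qed

lemma free_vars_foldr_Exi: "free_vars (foldr Exi xs \<phi>) = free_vars \<phi> - set xs"
  by (induction xs) auto

lemma sat_foldr_Exi:
  assumes "range e \<subseteq> K"
  shows "sat K e (foldr Exi xs \<phi>) \<longleftrightarrow>
    (\<exists>e'. range e' \<subseteq> K \<and> (\<forall>i. i \<notin> set xs \<longrightarrow> e' i = e i) \<and> sat K e' \<phi>)"
  using assms
proof (induction xs arbitrary: e)
  case Nil
  then show ?case
    by (auto simp flip: fun_eq_iff)
next
  case (Cons a xs)
  have "sat K e (foldr Exi (a # xs) \<phi>) \<longleftrightarrow>
    (\<exists>x\<in>K. \<exists>e'. range e' \<subseteq> K \<and> (\<forall>i. i \<notin> set xs \<longrightarrow> e' i = (e(a := x)) i) \<and> sat K e' \<phi>)"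
  proof -
    have "range (e(a := x)) \<subseteq> K" if "x \<in> K" for x
      using that Cons.prems by auto
    then show ?thesis
      using Cons.IH by simp
  qed
  also have "\<dots> \<longleftrightarrow> (\<exists>e'. range e' \<subseteq> K \<and> (\<forall>i. i \<notin> set (a # xs) \<longrightarrow> e' i = e i) \<and> sat K e' \<phi>)"
    (is "?l \<longleftrightarrow> ?r")
  proof
    assume ?l
    then obtain x e' where "range e' \<subseteq> K" "\<forall>i. i \<notin> set xs \<longrightarrow> e' i = (e(a := x)) i" "sat K e' \<phi>"
      by blast
    then show ?r
      by (intro exI[of _ e']) auto
  next
    assume ?r
    then obtain e' where e': "range e' \<subseteq> K" "\<forall>i. i \<notin> set (a # xs) \<longrightarrow> e' i = e i" "sat K e' \<phi>"
      by blast
    then show ?l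
      by (intro bexI[of _ "e' a"] exI[of _ e']) auto
  qed
  finally show ?case .
qed

text \<open>The existential closure of \<open>\<phi>\<close> is a sentence, true in \<open>K\<close>
  because \<open>e\<close> witnesses it. Only satisfiability transfers: \<open>e'\<close> has no
  further relation to \<open>e\<close>.\<close>

lemma elementarily_equivalent_transfer_sat:
  fixes K :: "'a::real_vector set" and K' :: "'b::real_vector set"
  assumes eq: "elementarily_equivalent K K'" and "K' \<noteq> {}"
    and e: "range e \<subseteq> K" "sat K e \<phi>"
  shows "\<exists>e'. range e' \<subseteq> K' \<and> sat K' e' \<phi>"
proof -
  obtain xs where xs: "set xs = free_vars \<phi>"
    using finite_list[OF finite_free_vars] by blast
  define \<psi> where "\<psi> = foldr Exi xs \<phi>"
  have "sentence \<psi>"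
    by (simp add: sentence_def \<psi>_def free_vars_foldr_Exi xs)
  have "models K \<psi>"
    unfolding models_def \<psi>_def
  proof (intro allI impI)
    fix d :: "nat \<Rightarrow> 'a"
    assume d: "range d \<subseteq> K"
    \<comment> \<open>The quantified variables take their values from \<open>e\<close>; elsewhere
      \<open>e'\<close> must agree with the arbitrary \<open>d\<close>, which \<open>\<phi>\<close>
      does not notice.\<close>
    define e' where "e' = (\<lambda>i. if i \<in> set xs then e i else d i)"
    have "sat K e' \<phi>"
      using sat_cong[of \<phi> e e' K] e(2) xs by (simp add: e'_def)
    then show "sat K d (foldr Exi xs \<phi>)"
      unfolding sat_foldr_Exi[OF d]
      using d e(1) by (intro exI[of _ e']) (auto simp: e'_def)
  qed
  then have "models K' \<psi>"
    using eq \<open>sentence \<psi>\<close> unfolding elementarily_equivalent_def by blast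
  \<comment> \<open>\<open>models\<close> is vacuous without assignments, so one into
    \<open>K'\<close> is needed to instantiate it.\<close>
  moreover obtain y where "range (\<lambda>i::nat. y) \<subseteq> K'"
    using \<open>K' \<noteq> {}\<close> by auto
  ultimately show ?thesis
    unfolding models_def \<psi>_def using sat_foldr_Exi by blast
qed

text \<open>\<open>Eq (Var 0) (Var 0)\<close> serves as the empty conjunction.\<close>

lemma sat_foldr_Conj:
  "sat K e (foldr Conj \<phi>s (Eq (Var 0) (Var 0))) \<longleftrightarrow> (\<forall>\<phi>\<in>set \<phi>s. sat K e \<phi>)"
  by (induction \<phi>s) auto

section \<open>Definable closed conditions\<close>

text \<open>Tychonoff's theorem for a countable power of \<open>K\<close>.\<close>

lemma compact_assignments:
  fixes K :: "'a::topological_space set"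
  assumes "compact K"
  shows "compact {e :: nat \<Rightarrow> 'a. range e \<subseteq> K}"
proof -
  have "compactin (product_topology (\<lambda>i::nat. euclidean) UNIV) (PiE UNIV (\<lambda>_. K))"
    using assms by (simp add: compactin_PiE)
  moreover have "PiE UNIV (\<lambda>_. K) = {e :: nat \<Rightarrow> 'a. range e \<subseteq> K}"
    by auto
  ultimately show ?thesis
    by (simp add: euclidean_product_topology)
qed

text \<open>Finite subfamilies of \<open>\<Phi>\<close> are realized in \<open>K'\<close> through
  their conjunction, so the closures have the finite intersection property in a compact space. The
  limit \<open>e'\<close> itself need not satisfy the formulas, only their closed
  consequences.\<close>

lemma elementarily_equivalent_realize_closure:
  fixes K K' :: "'a::euclidean_space set"
  assumes eq: "elementarily_equivalent K K'" and K': "compact K'" "K' \<noteq> {}"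
    and e: "range e \<subseteq> K"
    and sat: "\<And>\<phi>. \<phi> \<in> \<Phi> \<Longrightarrow> sat K e \<phi>"
  shows "\<exists>e'. \<forall>\<phi>\<in>\<Phi>. e' \<in> closure {e'. range e' \<subseteq> K' \<and> sat K' e' \<phi>}"
proof -
  define C where "C = (\<lambda>\<phi>. closure {e'. range e' \<subseteq> K' \<and> sat K' e' \<phi>})"
  have "{e'. range e' \<subseteq> K'} \<inter> \<Inter>(C ` \<Phi>) \<noteq> {}"
  proof (rule compact_imp_fip)
    show "compact {e' :: nat \<Rightarrow> 'a. range e' \<subseteq> K'}"
      by (rule compact_assignments) fact
    show "closed T" if "T \<in> C ` \<Phi>" for T
      using that by (auto simp: C_def)
    fix F
    assume F: "finite F" "F \<subseteq> C ` \<Phi>"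
    obtain \<Psi> where \<Psi>: "\<Psi> \<subseteq> \<Phi>" "finite \<Psi>" "F = C ` \<Psi>"
      using finite_subset_image[OF F] by auto
    obtain \<phi>s where \<phi>s: "set \<phi>s = \<Psi>"
      using finite_list[OF \<Psi>(2)] by auto
    have "sat K e (foldr Conj \<phi>s (Eq (Var 0) (Var 0)))"
      unfolding sat_foldr_Conj using sat \<Psi> \<phi>s by auto
    then obtain e' where e': "range e' \<subseteq> K'" "sat K' e' (foldr Conj \<phi>s (Eq (Var 0) (Var 0)))"
      using elementarily_equivalent_transfer_sat[OF eq K'(2) e] by blast
    then have "\<forall>\<phi>\<in>\<Psi>. e' \<in> C \<phi>"
      unfolding sat_foldr_Conj \<phi>s C_def by (auto intro!: subsetD[OF closure_subset])
    then show "{e'. range e' \<subseteq> K'} \<inter> \<Inter>F \<noteq> {}"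
      using e' \<open>F = C ` \<Psi>\<close> by blast
  qed
  then show ?thesis by (auto simp: C_def)
qed

section \<open>Affine combinations expressed by terms and formulas\<close>

lemma convex_combination_term:
  fixes w :: "nat \<Rightarrow> real"
  assumes "\<And>i. i \<le> n \<Longrightarrow> 0 < w i"
  shows "\<exists>s. term_vars s \<subseteq> {..n} \<and>
    (\<forall>e::nat \<Rightarrow> 'a::real_vector. (\<Sum>i\<le>n. w i) *\<^sub>R term_val e s = (\<Sum>i\<le>n. w i *\<^sub>R e i))"
  using assms
proof (induction n)
  case 0
  show ?case
    by (intro exI[of _ "Var 0"]) auto
next
  case (Suc n)
  then obtain s where s: "term_vars s \<subseteq> {..n}"
    "\<And>e::nat \<Rightarrow> 'a. (\<Sum>i\<le>n. w i) *\<^sub>R term_val e s = (\<Sum>i\<le>n. w i *\<^sub>R e i)"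
    by (metis le_SucI)
  define S where "S = (\<Sum>i\<le>n. w i)"
  have S: "S > 0" "w (Suc n) > 0"
    unfolding S_def using Suc.prems by (auto intro!: sum_pos)
  \<comment> \<open>The share of the new point in the total weight; positivity of the weights keeps
    the denominator nonzero.\<close>
  define l where "l = Weight (w (Suc n) / (S + w (Suc n)))"
  have l: "weight_of l = w (Suc n) / (S + w (Suc n))"
    unfolding l_def using S by (intro Weight_inverse) (auto simp: field_simps)
  have "(S + w (Suc n)) * weight_of l = w (Suc n)" "(S + w (Suc n)) * (1 - weight_of l) = S"
    using S by (auto simp: l field_simps)
  then have "(S + w (Suc n)) *\<^sub>R term_val e (Comb l s (Var (Suc n))) =
      S *\<^sub>R term_val e s + w (Suc n) *\<^sub>R e (Suc n)" for e :: "nat \<Rightarrow> 'a"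
    by (simp add: scaleR_right_distrib)
  then show ?case
    using s by (intro exI[of _ "Comb l s (Var (Suc n))"]) (auto simp: S_def)
qed

text \<open>Write \<open>t = u - v\<close> with \<open>u\<close> and \<open>v\<close> positive. The
  point \<open>y\<close> sought solves \<open>y + \<Sum> v i e i = \<Sum> u i e i\<close>, and
  division by \<open>1 + S\<close> turns both sides into convex combinations, hence terms.\<close>

lemma affine_combination_mem_formula:
  fixes t :: "nat \<Rightarrow> real"
  assumes t: "(\<Sum>i\<le>n. t i) = 1"
  shows "\<exists>\<phi>. \<forall>(K::'a::real_vector set) e. sat K e \<phi> \<longleftrightarrow> (\<Sum>i\<le>n. t i *\<^sub>R e i) \<in> K"
proof -
  \<comment> \<open>The summand 1 makes \<open>u\<close> and \<open>v\<close> strictly positive even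
    where \<open>t i\<close> vanishes, as the term construction requires.\<close>
  define v where "v = (\<lambda>i. \<bar>t i\<bar> + 1)"
  define u where "u = (\<lambda>i. t i + v i)"
  have pos: "v i > 0" "u i > 0" for i
    by (auto simp: u_def v_def)
  define S where "S = (\<Sum>i\<le>n. v i)"
  have S: "S > 0"
    unfolding S_def using pos by (auto intro!: sum_pos)
  have sum_u: "(\<Sum>i\<le>n. u i) = 1 + S"
    by (simp add: u_def S_def sum.distrib t)
  obtain p where p: "term_vars p \<subseteq> {..n}"
    "\<And>e::nat \<Rightarrow> 'a. (1 + S) *\<^sub>R term_val e p = (\<Sum>i\<le>n. u i *\<^sub>R e i)"
    using convex_combination_term[of n u] pos unfolding sum_u by blast
  obtain q where q: "term_vars q \<subseteq> {..n}"
    "\<And>e::nat \<Rightarrow> 'a. S *\<^sub>R term_val e q = (\<Sum>i\<le>n. v i *\<^sub>R e i)"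
    using convex_combination_term[of n v] pos unfolding S_def by blast
  define l where "l = Weight (S / (1 + S))"
  have l: "weight_of l = S / (1 + S)"
    unfolding l_def using S by (intro Weight_inverse) (auto simp: field_simps)
  have l': "(1 + S) * weight_of l = S" "(1 + S) * (1 - weight_of l) = 1"
    using S by (auto simp: l field_simps)
  \<comment> \<open>Variable \<open>Suc n\<close> is fresh, since \<open>p\<close> and
    \<open>q\<close> use only variables up to \<open>n\<close>.\<close>
  define \<phi> where "\<phi> = Exi (Suc n) (Eq (Comb l (Var (Suc n)) q) p)"
  have "sat K e \<phi> \<longleftrightarrow> (\<Sum>i\<le>n. t i *\<^sub>R e i) \<in> K" for K :: "'a set" and e
  proof -
    have eq: "(1 - weight_of l) *\<^sub>R y + weight_of l *\<^sub>R term_val (e(Suc n := y)) q =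
        term_val (e(Suc n := y)) p \<longleftrightarrow> y = (\<Sum>i\<le>n. t i *\<^sub>R e i)" (is "?a = ?b \<longleftrightarrow> _") for y
    proof -
      have *: "term_val (e(Suc n := y)) q = term_val e q" "term_val (e(Suc n := y)) p = term_val e p"
        using p(1) q(1) by (auto intro!: term_val_cong)
      have "?a = ?b \<longleftrightarrow> (1 + S) *\<^sub>R ?a = (1 + S) *\<^sub>R ?b"
        using S by simp
      also have "(1 + S) *\<^sub>R ?a = y + S *\<^sub>R term_val e q"
        unfolding scaleR_right_distrib scaleR_scaleR l' * by simp
      also have "(1 + S) *\<^sub>R ?b = (\<Sum>i\<le>n. t i *\<^sub>R e i) + S *\<^sub>R term_val e q"
        unfolding * p q by (simp add: u_def scaleR_left_distrib sum.distrib)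
      finally show ?thesis
        unfolding add_right_cancel .
    qed
    show ?thesis
      unfolding \<phi>_def sat.simps term_val.simps fun_upd_same eq by blast
  qed
  then show ?thesis by blast
qed

section \<open>Interiority as a closed first-order condition\<close>

text \<open>For \<open>l > 0\<close> these are the centres \<open>q\<close> for which the homothety
  of ratio \<open>-(1 - l) / l\<close> maps \<open>K\<close> into itself: \<open>z\<close> is the
  image of \<open>y\<close>.\<close>

definition reflection_core :: "real \<Rightarrow> 'a::real_vector set \<Rightarrow> 'a set" where
  "reflection_core l K = {q. \<forall>y\<in>K. \<exists>z\<in>K. (1 - l) *\<^sub>R y + l *\<^sub>R z = q}"

lemma reflection_core_formula:
  assumes "0 \<le> l" "l \<le> 1"
  shows "\<exists>\<phi>. \<forall>(K::'a::real_vector set) e. sat K e \<phi> \<longleftrightarrow> e 0 \<in> reflection_core l K"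
proof -
  have "weight_of (Weight l) = l"
    using assms by (intro Weight_inverse) auto
  then show ?thesis
    by (intro exI[of _ "Neg (Exi 1 (Neg (Exi 2 (Eq (Comb (Weight l) (Var 1) (Var 2)) (Var 0)))))"])
      (auto simp: reflection_core_def)
qed

text \<open>For fixed \<open>y\<close> the admissible \<open>q\<close> form an affine image of the
  compact \<open>K\<close>; the quantifier over \<open>y\<close> intersects these images.\<close>

lemma closed_reflection_core:
  fixes K :: "'a::real_normed_vector set"
  assumes "compact K"
  shows "closed (reflection_core l K)"
proof -
  have "reflection_core l K = (\<Inter>y\<in>K. (\<lambda>z. (1 - l) *\<^sub>R y + l *\<^sub>R z) ` K)"
    by (auto simp: reflection_core_def)
  moreover have "compact ((\<lambda>z. (1 - l) *\<^sub>R y + l *\<^sub>R z) ` K)" for y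
    by (intro compact_continuous_image continuous_intros assms)
  ultimately show ?thesis
    by (simp add: closed_INT compact_imp_closed)
qed

text \<open>It suffices to test an interior \<open>y\<close>: then \<open>q\<close> is a convex
  combination giving positive weight \<open>1 - l\<close> to an interior point.\<close>

lemma reflection_core_subset_interior:
  fixes K :: "'a::euclidean_space set"
  assumes "convex K" "interior K \<noteq> {}" "0 \<le> l" "l < 1"
  shows "reflection_core l K \<subseteq> interior K"
proof
  fix q
  assume q: "q \<in> reflection_core l K"
  obtain y where y: "y \<in> interior K"
    using assms by auto
  then have "y \<in> K"
    using interior_subset by auto
  then obtain z where z: "z \<in> K" "(1 - l) *\<^sub>R y + l *\<^sub>R z = q"
    using q by (auto simp: reflection_core_def)
  have "z - (1 - l) *\<^sub>R (z - y) \<in> interior K"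
    using assms y z by (intro mem_interior_convex_shrink) auto
  also have "z - (1 - l) *\<^sub>R (z - y) = q"
    using z by (simp add: algebra_simps)
  finally show "q \<in> interior K" .
qed

lemma interior_point_in_reflection_core:
  fixes K :: "'a::real_normed_vector set"
  assumes "bounded K" "c \<in> interior K"
  shows "\<exists>l. 0 \<le> l \<and> l < 1 \<and> c \<in> reflection_core l K"
proof -
  obtain r where r: "r > 0" "cball c r \<subseteq> K"
    using assms by (auto simp: mem_interior_cball)
  obtain R where R: "R > 0" "\<And>y. y \<in> K \<Longrightarrow> norm (c - y) \<le> R"
  proof -
    have "bounded ((\<lambda>y. c - y) ` K)"
      by (rule bounded_minus_comp) (use assms in \<open>auto simp: image_constant_conv\<close>)
    then show ?thesis
      using that by (auto simp: bounded_pos)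
  qed
  \<comment> \<open>Chosen so that the ratio \<open>(1 - l) / l\<close> is \<open>r / R\<close>,
    which shrinks \<open>K\<close>, within distance \<open>R\<close> of \<open>c\<close>, into the
    ball of radius \<open>r\<close>.\<close>
  define l where "l = R / (R + r)"
  have "1 - l = r / (R + r)"
    using r R by (simp add: l_def field_simps)
  then have l: "0 < l" "l < 1" "(1 - l) / l = r / R"
    using r R by (simp_all add: l_def)
  have "c \<in> reflection_core l K"
    unfolding reflection_core_def
  proof (clarsimp)
    fix y
    assume y: "y \<in> K"
    define z where "z = c + ((1 - l) / l) *\<^sub>R (c - y)"
    have "norm (z - c) = r / R * norm (c - y)"
      unfolding z_def l(3) using r R by simp
    also have "\<dots> \<le> r / R * R"
      using r R y by (intro mult_left_mono) auto
    finally have "norm (z - c) \<le> r"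
      using R by simp
    then have "z \<in> K"
      using r by (auto simp: dist_norm norm_minus_commute)
    moreover have "l *\<^sub>R z = l *\<^sub>R c + (1 - l) *\<^sub>R (c - y)"
      using l(1) by (simp add: z_def scaleR_right_distrib)
    then have "(1 - l) *\<^sub>R y + l *\<^sub>R z = c"
      by (simp add: algebra_simps)
    ultimately show "\<exists>z\<in>K. (1 - l) *\<^sub>R y + l *\<^sub>R z = c"
      by blast
  qed
  then show ?thesis
    using l by (intro exI[of _ l]) auto
qed

section \<open>Affine frames and reconstruction of the body\<close>

text \<open>The frame consists of \<open>c\<close> and small steps from it along the basis vectors;
  the functions \<open>t i\<close> with \<open>i \<le> n\<close> are its barycentric
  coordinates.\<close>

lemma affine_frame_exists:
  fixes K :: "'a::euclidean_space set"
  assumes c: "c \<in> interior K"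
  obtains p and t :: "nat \<Rightarrow> 'a \<Rightarrow> real" and n where
    "range p \<subseteq> K" "\<And>i. t i c = (if i = 0 then 1 else 0)"
    "\<And>x. (\<Sum>i\<le>n. t i x) = 1" "\<And>x. (\<Sum>i\<le>n. t i x *\<^sub>R p i) = x"
    "\<And>i. affine_map (t i)"
proof -
  obtain d where d: "d > 0" "cball c d \<subseteq> K"
    using c by (auto simp: mem_interior_cball)
  obtain b where b: "bij_betw b {..<DIM('a)} (Basis :: 'a set)"
    using ex_bij_betw_nat_finite[OF finite_Basis] atLeast0LessThan by metis
  obtain n where n: "DIM('a) = n"
    by simp
  \<comment> \<open>Index 0 is taken by \<open>c\<close>, whence the shift \<open>i - 1\<close>. The
    default \<open>c\<close> beyond \<open>n\<close> makes \<open>p\<close> a total assignment into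
    \<open>K\<close>.\<close>
  define p where "p = (\<lambda>i. if 0 < i \<and> i \<le> n then c + d *\<^sub>R b (i - 1) else c)"
  define s where "s = (\<lambda>j x. inner (x - c) (b j) / d)"
  define t where "t = (\<lambda>i x. if i = 0 then 1 - (\<Sum>j<n. s j x) else s (i - 1) x)"
  have bB: "b j \<in> Basis" if "j < n" for j
    using b that n by (auto simp: bij_betw_def)
  have "c + d *\<^sub>R b j \<in> K" if "j < n" for j
    using d bB[OF that] by (auto simp: dist_norm)
  moreover have "c \<in> K"
    using c interior_subset by auto
  ultimately have "range p \<subseteq> K"
    by (auto simp: p_def)
  moreover have "t i c = (if i = 0 then 1 else 0)" for i
    by (simp add: t_def s_def)
  moreover have "(\<Sum>i\<le>n. t i x) = 1" for x
    by (simp add: sum.atMost_shift t_def)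
  moreover have "(\<Sum>i\<le>n. t i x *\<^sub>R p i) = x" for x
  proof -
    have "(\<Sum>i\<le>n. t i x *\<^sub>R p i) = (1 - (\<Sum>j<n. s j x)) *\<^sub>R c + (\<Sum>j<n. s j x *\<^sub>R (c + d *\<^sub>R b j))"
      by (simp add: sum.atMost_shift t_def p_def)
    also have "\<dots> = c + (\<Sum>j<n. inner (x - c) (b j) *\<^sub>R b j)"
      using d by (simp add: s_def scaleR_right_distrib sum.distrib scaleR_left_diff_distrib
          scaleR_sum_left)
    also have "(\<Sum>j<n. inner (x - c) (b j) *\<^sub>R b j) = (\<Sum>v\<in>Basis. inner (x - c) v *\<^sub>R v)"
      using sum.reindex_bij_betw[OF b, of "\<lambda>v. inner (x - c) v *\<^sub>R v"] n by simp
    finally show ?thesis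
      by (simp add: euclidean_representation)
  qed
  moreover have "affine_map (t i)" for i
  proof (cases "i = 0")
    case True
    have "linear (\<lambda>x. - (\<Sum>j<n. inner x (b j) / d))"
      by (intro linearI) (simp_all add: inner_left_distrib add_divide_distrib sum.distrib
          sum_distrib_left)
    moreover have "t i x = - (\<Sum>j<n. inner x (b j) / d) + (1 + (\<Sum>j<n. inner c (b j) / d))" for x
      using True by (simp add: t_def s_def inner_diff_left diff_divide_distrib sum_subtractf)
    ultimately show ?thesis
      unfolding affine_map_def by blast
  next
    case False
    have "linear (\<lambda>x. inner x (b (i - 1)) / d)"
      by (intro linearI) (simp_all add: inner_left_distrib add_divide_distrib)
    moreover have "t i x = inner x (b (i - 1)) / d + (- (inner c (b (i - 1)) / d))" for x
      using False by (simp add: t_def s_def inner_diff_left diff_divide_distrib)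
    ultimately show ?thesis
      unfolding affine_map_def by blast
  qed
  ultimately show ?thesis
    by (rule that)
qed

lemma affine_map_sum_scaleR:
  assumes "\<And>i. affine_map (t i)"
  shows "affine_map (\<lambda>x. \<Sum>i\<in>I. t i x *\<^sub>R a i)"
proof -
  obtain L c where L: "\<And>i. linear (L i)" and t: "\<And>i x. t i x = L i x + c i"
    using assms unfolding affine_map_def by metis
  have "linear (\<lambda>x. \<Sum>i\<in>I. L i x *\<^sub>R a i)"
    by (intro linearI) (simp_all add: linear_add[OF L] linear_scale[OF L] scaleR_left_distrib
        sum.distrib scaleR_sum_right)
  moreover have "(\<Sum>i\<in>I. t i x *\<^sub>R a i) = (\<Sum>i\<in>I. L i x *\<^sub>R a i) + (\<Sum>i\<in>I. c i *\<^sub>R a i)" for x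
    by (simp add: t scaleR_left_distrib sum.distrib)
  ultimately show ?thesis
    unfolding affine_map_def by blast
qed

text \<open>Points differing by a kernel vector of the linear part have the same image, so the fibre
  of \<open>F\<close> over \<open>F c\<close>, which lies in the bounded \<open>K\<close>, is a
  single point. Once \<open>F\<close> is bijective, the image of \<open>K\<close> is closed and
  contains \<open>interior K'\<close>, hence its closure.\<close>

lemma affine_map_onto_convex_body:
  fixes K K' :: "'a::euclidean_space set"
  assumes K: "convex_body K" and K': "convex_body K'" and F: "affine_map F"
    and sub: "F ` K \<subseteq> K'" and vimage: "F -` interior K' \<subseteq> K" and c: "F c \<in> interior K'"
  shows "bij F \<and> F ` K = K'"
proof -
  obtain L a where L: "linear L" and Fx: "\<And>x. F x = L x + a"
    using F unfolding affine_map_def by blast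
  have "v = 0" if "L v = 0" for v
  proof (rule ccontr)
    assume "v \<noteq> 0"
    have "c + s *\<^sub>R v \<in> K" for s
    proof -
      have "F (c + s *\<^sub>R v) = F c"
        by (simp add: Fx linear_add[OF L] linear_scale[OF L] that)
      then show ?thesis
        using vimage c by auto
    qed
    moreover obtain R where "\<And>x. x \<in> K \<Longrightarrow> norm x \<le> R"
      using K compact_imp_bounded[of K] unfolding convex_body_def bounded_iff by blast
    ultimately have "norm (c + s *\<^sub>R v) \<le> R" for s
      by blast
    then have "norm (s *\<^sub>R v) \<le> R + norm c" for s
      using norm_triangle_ineq4[of "c + s *\<^sub>R v" c] by (smt (verit) add_diff_cancel_left')
    \<comment> \<open>This multiple of \<open>v\<close> has norm exceeding the bound by 1.\<close>
    from this[of "(R + norm c + 1) / norm v"] have "\<bar>R + norm c + 1\<bar> \<le> R + norm c"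
      using \<open>v \<noteq> 0\<close> by simp
    then show False by simp
  qed
  then have "inj L"
    using linear_injective_0[OF L] by blast
  then have "bij L"
    using linear_injective_imp_surjective[OF L] by (simp add: bij_def)
  then have "bij F"
  proof -
    have "F = (\<lambda>x. x + a) \<circ> L"
      by (auto simp: Fx)
    then show ?thesis
      using bij_comp[OF \<open>bij L\<close> bij_plus_right[of a]] by simp
  qed
  moreover have "K' \<subseteq> F ` K"
  proof -
    have "interior K' \<subseteq> F ` K"
      using vimage \<open>bij F\<close> by (metis bij_is_surj image_mono surj_image_vimage_eq)
    moreover have "continuous_on K F"
      unfolding Fx[abs_def] using L
      by (intro continuous_intros linear_continuous_on) (simp add: linear_conv_bounded_linear)
    then have "closed (F ` K)"
      using K by (auto simp: convex_body_def intro!: compact_imp_closed compact_continuous_image)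
    ultimately have "closure (interior K') \<subseteq> F ` K"
      by (rule closure_minimal)
    moreover have "closure (interior K') = closure K'"
      using K' by (intro convex_closure_interior) (auto simp: convex_body_def)
    ultimately show ?thesis
      using closure_subset[of K'] by auto
  qed
  ultimately show ?thesis
    using sub by auto
qed

lemma elementarily_equivalent_imp_affinely_equivalent:
  fixes K K' :: "'a::euclidean_space set"
  assumes K: "convex_body K" and K': "convex_body K'" and eq: "elementarily_equivalent K K'"
  shows "affinely_equivalent K K'"
proof -
  have cK': "compact K'" "K' \<noteq> {}" "convex K'" "interior K' \<noteq> {}"
    using K' interior_subset[of K'] by (auto simp: convex_body_def)
  obtain c where c: "c \<in> interior K"
    using K by (auto simp: convex_body_def)
  obtain p t n where p: "range p \<subseteq> K" and tc: "\<And>i. t i c = (if i = 0 then 1 else 0)"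
    and t: "\<And>x. (\<Sum>i\<le>n. t i x) = 1" "\<And>x. (\<Sum>i\<le>n. t i x *\<^sub>R p i) = x"
    and aff: "\<And>i::nat. affine_map (t i :: 'a \<Rightarrow> real)"
    by (rule affine_frame_exists[OF c]) blast
  \<comment> \<open>\<open>F e\<close> is the affine map sending the frame to the tuple
    \<open>e\<close>; in particular \<open>F p\<close> is the identity.\<close>
  define F where "F = (\<lambda>(e::nat \<Rightarrow> 'a) x. \<Sum>i\<le>n. t i x *\<^sub>R e i)"
  \<comment> \<open>Thus \<open>\<psi>\<close>, which speaks of variable 0, is a condition on the
    image of \<open>c\<close>.\<close>
  have F_c: "F e c = e 0" for e
    by (simp add: F_def tc if_distrib[of "\<lambda>u. u *\<^sub>R _"] cong: if_cong)
  then have "p 0 = c"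
    using t(2) by (simp add: F_def flip: F_c)
  have "continuous_on UNIV (\<lambda>e. F e x)" for x
    unfolding F_def
    by (intro continuous_intros continuous_on_product_coordinates)
  then have closed_F: "closed ((\<lambda>e. F e x) -` S)" if "closed S" for x S
    using that by (auto simp: continuous_on_closed_vimage)
  obtain l where l: "0 \<le> l" "l < 1" "c \<in> reflection_core l K"
    using interior_point_in_reflection_core[OF _ c] K
    by (auto simp: convex_body_def dest: compact_imp_bounded)
  obtain \<psi> where \<psi>: "\<And>(K::'a set) e. sat K e \<psi> \<longleftrightarrow> e 0 \<in> reflection_core l K"
    using reflection_core_formula[of l] l by (metis less_imp_le)
  have "\<exists>\<phi>. \<forall>(K::'a set) e. sat K e \<phi> \<longleftrightarrow> F e x \<in> K" for x
    unfolding F_def using affine_combination_mem_formula[OF t(1)] by blast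
  then obtain \<phi> where \<phi>: "\<And>x (K::'a set) e. sat K e (\<phi> x) \<longleftrightarrow> F e x \<in> K"
    by metis
  define \<Phi> where "\<Phi> = insert \<psi> (\<phi> ` K \<union> (\<lambda>x. Neg (\<phi> x)) ` (- K))"
  \<comment> \<open>All conditions hold at \<open>p\<close> because \<open>F p\<close> is the
    identity and \<open>p 0 = c\<close>.\<close>
  have "sat K p \<theta>" if "\<theta> \<in> \<Phi>" for \<theta>
    using that l \<open>p 0 = c\<close> t by (auto simp: \<Phi>_def \<psi> \<phi> F_def)
  then obtain e where
    e: "\<And>\<theta>. \<theta> \<in> \<Phi> \<Longrightarrow> e \<in> closure {e'. range e' \<subseteq> K' \<and> sat K' e' \<theta>}"
    using elementarily_equivalent_realize_closure[OF eq cK'(1,2) p] by metis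
  \<comment> \<open>The limit \<open>e\<close> inherits any closed consequence of a formula in
    \<open>\<Phi>\<close>; below, the closed sets are preimages of \<open>K'\<close>, of the
    complement of its interior, and of its reflection core.\<close>
  have in_closed: "e \<in> S"
    if "\<theta> \<in> \<Phi>" "closed S" "\<And>e. range e \<subseteq> K' \<Longrightarrow> sat K' e \<theta> \<Longrightarrow> e \<in> S" for \<theta> S
  proof -
    have "{e'. range e' \<subseteq> K' \<and> sat K' e' \<theta>} \<subseteq> S"
      using that(3) by auto
    then have "closure {e'. range e' \<subseteq> K' \<and> sat K' e' \<theta>} \<subseteq> S"
      using that(2) by (rule closure_minimal)
    then show ?thesis
      using e[OF that(1)] by (rule subsetD)
  qed
  have "F e x \<in> K'" if "x \<in> K" for x
  proof -
    have "e \<in> (\<lambda>e. F e x) -` K'"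
      using that cK' by (intro in_closed[of "\<phi> x"] closed_F compact_imp_closed)
        (auto simp: \<Phi>_def \<phi>)
    then show ?thesis by simp
  qed
  moreover have "F e x \<notin> interior K'" if "x \<notin> K" for x
  proof -
    have "e \<in> (\<lambda>e. F e x) -` (- interior K')"
      using that interior_subset[of K'] by (intro in_closed[of "Neg (\<phi> x)"] closed_F)
        (auto simp: \<Phi>_def \<phi>)
    then show ?thesis by simp
  qed
  moreover have "F e c \<in> interior K'"
  proof -
    have "e \<in> (\<lambda>e. F e c) -` reflection_core l K'"
      using closed_reflection_core[OF cK'(1)]
      by (intro in_closed[of \<psi>] closed_F) (auto simp: \<Phi>_def \<psi> F_c)
    then show ?thesis
      using reflection_core_subset_interior[OF cK'(3,4) l(1,2)] by auto
  qed
  moreover have "affine_map (F e)"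
    unfolding F_def by (rule affine_map_sum_scaleR) (rule aff)
  ultimately show ?thesis
    unfolding affinely_equivalent_def
    using affine_map_onto_convex_body[OF K K', of "F e" c] by blast
qed

theorem theorem1p1:
  fixes K K' :: "(real ^ 'n) set"
  assumes "convex_body K" and "convex_body K'"
  shows "elementarily_equivalent K K' \<longleftrightarrow> affinely_equivalent K K'"
  using elementarily_equivalent_imp_affinely_equivalent[OF assms]
    affinely_equivalent_imp_elementarily_equivalent by blast

end
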